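(* Let $S$ be an amiable semigroup. Then $S$ is adequate if and only if $S$ avoids both of the semigroups defined by the semigroup presentations $$F = \langle a, b \mid a^2 = a,\ b^2 = b \rangle \quad\text{and}\quad M = \langle a, b \mid a^2 = a,\ b^2 = b,\ aba = bab = ab \rangle .$$
   Context: For a semigroup $S$, let $S^1 = S$ if $S$ is a monoid, and otherwise let $S^1 = S\cup\{1\}$ be $S$ with an identity element adjoined. The relations $\mathcal{L}^*$ and $\mathcal{R}^*$ on $S$ are defined by: $x\,\mathcal{L}^*\,y$ iff for all $a,b\in S^1$, $xa=xb \Leftrightarrow ya=yb$; and $x\,\mathcal{R}^*\,y$ iff for all $a,b\in S^1$, $ax=bx\Leftrightarrow ay=by$. Both are equivalence relations. A semigroup is abundant if each $\mathcal{L}^*$-class and each $\mathcal{R}^*$-class contains at least one idempotent. A semigroup is amiable if each $\mathcal{L}^*$-class and each $\mathcal{R}^*$-class contains exactly one idempotent. A semigroup is adequate if it is abundant and its idempotents commute. A semigroup $S$ avoids a semigroup $T$ if no subsemigroup of $S$ is isomorphic to $T$. The presentations are semigroup (not monoid) presentations. *)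

theory Defs
  imports Main
begin

text \<open>
  A semigroup \<open>S\<close> is a type of class \<^class>\<open>semigroup_mult\<close>; properties of \<open>S\<close> as a whole are
  predicates on \<^typ>\<open>'a itself\<close>.

  \<open>S\<^sup>1\<close> is represented inside \<^typ>\<open>'a option\<close>, with \<^const>\<open>None\<close> as the adjoined identity.
  When \<open>S\<close> already has an identity, \<open>S\<^sup>1\<close> is \<open>S\<close> itself and \<^const>\<open>None\<close> does not belong to it.
\<close>

definition has_identity :: "'a::semigroup_mult itself \<Rightarrow> bool" where
  "has_identity _ \<longleftrightarrow> (\<exists>e::'a. \<forall>x. e * x = x \<and> x * e = x)"

definition S1 :: "'a::semigroup_mult option set" where
  "S1 = (if has_identity TYPE('a) then range Some else UNIV)"

fun mult1 :: "'a::semigroup_mult option \<Rightarrow> 'a option \<Rightarrow> 'a option" (infixl "\<odot>" 70) where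
  "Some x \<odot> Some y = Some (x * y)"
| "None \<odot> v = v"
| "u \<odot> None = u"

definition Lstar :: "('a::semigroup_mult \<times> 'a) set" where
  "Lstar = {(x, y). \<forall>a\<in>S1. \<forall>b\<in>S1.
      Some x \<odot> a = Some x \<odot> b \<longleftrightarrow> Some y \<odot> a = Some y \<odot> b}"

definition Rstar :: "('a::semigroup_mult \<times> 'a) set" where
  "Rstar = {(x, y). \<forall>a\<in>S1. \<forall>b\<in>S1.
      a \<odot> Some x = b \<odot> Some x \<longleftrightarrow> a \<odot> Some y = b \<odot> Some y}"

lemma equiv_Lstar: "equiv UNIV Lstar"
  by (rule equivI) (auto simp: Lstar_def refl_on_def sym_def trans_def)

lemma equiv_Rstar: "equiv UNIV Rstar"
  by (rule equivI) (auto simp: Rstar_def refl_on_def sym_def trans_def)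

definition idem :: "'a::semigroup_mult \<Rightarrow> bool" where
  "idem e \<longleftrightarrow> e * e = e"

definition abundant :: "'a::semigroup_mult itself \<Rightarrow> bool" where
  "abundant _ \<longleftrightarrow>
    (\<forall>C \<in> UNIV // (Lstar :: ('a \<times> 'a) set). \<exists>e\<in>C. idem e) \<and>
    (\<forall>C \<in> UNIV // (Rstar :: ('a \<times> 'a) set). \<exists>e\<in>C. idem e)"

definition amiable :: "'a::semigroup_mult itself \<Rightarrow> bool" where
  "amiable _ \<longleftrightarrow>
    (\<forall>C \<in> UNIV // (Lstar :: ('a \<times> 'a) set). \<exists>!e. e \<in> C \<and> idem e) \<and>
    (\<forall>C \<in> UNIV // (Rstar :: ('a \<times> 'a) set). \<exists>!e. e \<in> C \<and> idem e)"

definition adequate :: "'a::semigroup_mult itself \<Rightarrow> bool" where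
  "adequate _ \<longleftrightarrow> abundant TYPE('a) \<and> (\<forall>e f :: 'a. idem e \<longrightarrow> idem f \<longrightarrow> e * f = f * e)"

definition subsemigroup :: "'a::semigroup_mult set \<Rightarrow> bool" where
  "subsemigroup H \<longleftrightarrow> H \<noteq> {} \<and> (\<forall>x\<in>H. \<forall>y\<in>H. x * y \<in> H)"

definition isomorphic_to :: "'a::semigroup_mult set \<Rightarrow> 'b::semigroup_mult itself \<Rightarrow> bool" where
  "isomorphic_to H _ \<longleftrightarrow>
    (\<exists>\<phi> :: 'b \<Rightarrow> 'a. bij_betw \<phi> UNIV H \<and> (\<forall>x y. \<phi> (x * y) = \<phi> x * \<phi> y))"

definition avoids :: "'a::semigroup_mult itself \<Rightarrow> 'b::semigroup_mult itself \<Rightarrow> bool" where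
  "avoids _ T \<longleftrightarrow> \<not> (\<exists>H :: 'a set. subsemigroup H \<and> isomorphic_to H T)"

text \<open>
  Semigroup presentations: the free semigroup consists of the nonempty words, and the presented
  semigroup is its quotient by the least congruence containing the defining relations.
\<close>

typedef 'g free_semigroup = "{w :: 'g list. w \<noteq> []}"
  by auto

setup_lifting type_definition_free_semigroup

lift_definition gen :: "'g \<Rightarrow> 'g free_semigroup" is "\<lambda>g. [g]"
  by simp

instantiation free_semigroup :: (type) semigroup_mult
begin

lift_definition times_free_semigroup ::
    "'g free_semigroup \<Rightarrow> 'g free_semigroup \<Rightarrow> 'g free_semigroup" is "(@)"
  by simp

instance
  by (standard; transfer; simp)

end

inductive sg_cong :: "('s::semigroup_mult \<times> 's) set \<Rightarrow> 's \<Rightarrow> 's \<Rightarrow> bool" for R where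
  rel: "(u, v) \<in> R \<Longrightarrow> sg_cong R u v"
| refl: "sg_cong R u u"
| sym: "sg_cong R u v \<Longrightarrow> sg_cong R v u"
| trans: "sg_cong R u v \<Longrightarrow> sg_cong R v w \<Longrightarrow> sg_cong R u w"
| mult: "sg_cong R u v \<Longrightarrow> sg_cong R u' v' \<Longrightarrow> sg_cong R (u * u') (v * v')"

lemma equivp_sg_cong: "equivp (sg_cong R)"
  by (rule equivpI)
    (auto intro: reflpI sympI transpI sg_cong.refl sg_cong.sym sg_cong.trans)

datatype letter = LA | LB

definition wa :: "letter free_semigroup" where "wa = gen LA"
definition wb :: "letter free_semigroup" where "wb = gen LB"

definition F_rels :: "(letter free_semigroup \<times> letter free_semigroup) set" where
  "F_rels = {(wa * wa, wa), (wb * wb, wb)}"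

definition M_rels :: "(letter free_semigroup \<times> letter free_semigroup) set" where
  "M_rels = {(wa * wa, wa), (wb * wb, wb),
             (wa * wb * wa, wb * wa * wb), (wb * wa * wb, wa * wb)}"

quotient_type sg_F = "letter free_semigroup" / "sg_cong F_rels"
  by (rule equivp_sg_cong)

quotient_type sg_M = "letter free_semigroup" / "sg_cong M_rels"
  by (rule equivp_sg_cong)

instantiation sg_F :: semigroup_mult
begin

lift_definition times_sg_F :: "sg_F \<Rightarrow> sg_F \<Rightarrow> sg_F" is "(*)"
  by (rule sg_cong.mult)

instance
  by (standard; transfer) (simp add: mult.assoc sg_cong.refl)

end

instantiation sg_M :: semigroup_mult
begin

lift_definition times_sg_M :: "sg_M \<Rightarrow> sg_M \<Rightarrow> sg_M" is "(*)"
  by (rule sg_cong.mult)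

instance
  by (standard; transfer) (simp add: mult.assoc sg_cong.refl)

end

end

theory Submission
  imports Defs
begin

text \<open>
  Let \<open>a\<close>, \<open>b\<close> be noncommuting idempotents of an amiable semigroup. If they do not generate a copy of
  \<open>F\<close>, then two alternating words in \<open>a\<close> and \<open>b\<close> coincide, so some power \<open>z = (ab)\<^sup>n\<close> is idempotent.
  The idempotents \<open>za\<close> and \<open>bz\<close> are \<open>\<R>\<^sup>*\<close>- resp. \<open>\<L>\<^sup>*\<close>-related to \<open>z\<close>, hence equal to \<open>z\<close>, and \<open>z\<close> is a
  zero of the subsemigroup generated by \<open>a\<close> and \<open>b\<close>. If \<open>ab = z\<close>, then \<open>a\<close> and \<open>b\<close> generate a copy
  of \<open>M\<close>. Otherwise let \<open>w\<close> be a longest nonzero word \<open>abab\<dots>\<close>, say \<open>w = \<dots>ab\<close>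
  with \<open>wa = z\<close>, and let \<open>c\<close> be the idempotent in its \<open>\<L>\<^sup>*\<close>-class. Then \<open>bc = c\<close> and \<open>ca = z\<close>, whereas
  \<open>ac = z\<close> would give \<open>w = wc = \<dots>abc = \<dots>ac = z\<close>. So \<open>c\<close> and \<open>a\<close> generate a copy of \<open>M\<close>.
\<close>

section \<open>Idempotents in starred Green classes\<close>

text \<open>Left multiplication by \<open>e\<close> turns \<open>f * a = f * b\<close> into
  \<open>e * a = e * b\<close>, and left multiplication by \<open>f\<close> goes back.\<close>

lemma Lstar_idemI:
  fixes e f :: "'a::semigroup_mult"
  assumes "e * f = e" "f * e = f"
  shows "(e, f) \<in> Lstar"
proof -
  have assoc: "Some x \<odot> (Some y \<odot> u) = Some (x * y) \<odot> u" for x y :: 'a and u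
    by (cases u) (auto simp: mult.assoc)
  show ?thesis
    unfolding Lstar_def by (auto) (metis assoc assms)+
qed

lemma Rstar_idemI:
  fixes e f :: "'a::semigroup_mult"
  assumes "e * f = f" "f * e = e"
  shows "(e, f) \<in> Rstar"
proof -
  have assoc: "(u \<odot> Some x) \<odot> Some y = u \<odot> Some (x * y)" for x y :: 'a and u
    by (cases u) (auto simp: mult.assoc)
  show ?thesis
    unfolding Rstar_def by (auto) (metis assoc assms)+
qed

lemma Lstar_cancel:
  fixes x y :: "'a::semigroup_mult"
  assumes "(x, y) \<in> Lstar" "x * a = x * b"
  shows "y * a = y * b"
proof -
  have "Some a \<in> S1" "Some b \<in> S1"
    by (auto simp: S1_def)
  with assms show ?thesis
    unfolding Lstar_def by (metis (mono_tags, lifting) case_prodD mem_Collect_eq mult1.simps(1) option.inject)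
qed

text \<open>The equation \<open>e * e = e * 1\<close> is transferred from \<open>e\<close> to
  \<open>x\<close>. The identity is \<open>i\<close> or \<open>None\<close>, since
  \<open>None\<close> lies in \<open>S1\<close> only if the semigroup has no identity.\<close>

lemma Lstar_idem_right_identity:
  fixes x e :: "'a::semigroup_mult"
  assumes "(x, e) \<in> Lstar" "idem e"
  shows "x * e = x"
proof (cases "has_identity TYPE('a)")
  case True
  then obtain i :: 'a where i: "\<And>x. i * x = x" "\<And>x. x * i = x"
    unfolding has_identity_def by blast
  have "(e, x) \<in> Lstar"
    using assms(1) equiv_Lstar by (meson equivE symE)
  then have "x * e = x * i"
    by (rule Lstar_cancel) (use assms(2) i in \<open>simp add: idem_def\<close>)
  then show ?thesis
    by (simp add: i)
next
  case False
  then have "Some x \<odot> Some e = Some x \<odot> None \<longleftrightarrow> Some e \<odot> Some e = Some e \<odot> None"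
    using assms(1) unfolding Lstar_def S1_def by (simp del: mult1.simps)
  with assms(2) show ?thesis
    by (simp add: idem_def)
qed

lemma amiable_Lstar_idem:
  fixes x :: "'a::semigroup_mult"
  assumes "amiable TYPE('a)"
  obtains e where "(x, e) \<in> Lstar" "idem e"
proof -
  have "Lstar `` {x} \<in> UNIV // Lstar"
    by (simp add: quotientI)
  then have "\<exists>!e. e \<in> Lstar `` {x} \<and> idem e"
    by (rule amiable_def[THEN iffD1, OF assms, THEN conjunct1, THEN bspec])
  with that show thesis
    by blast
qed

lemma amiable_Lstar_unique:
  fixes e f :: "'a::semigroup_mult"
  assumes "amiable TYPE('a)" "idem e" "idem f" "e * f = e" "f * e = f"
  shows "e = f"
proof -
  have "Lstar `` {e} \<in> UNIV // Lstar"
    by (simp add: quotientI)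
  then have "\<exists>!g. g \<in> Lstar `` {e} \<and> idem g"
    by (rule amiable_def[THEN iffD1, OF assms(1), THEN conjunct1, THEN bspec])
  moreover have "f \<in> Lstar `` {e}" "e \<in> Lstar `` {e}"
    using Lstar_idemI assms by (auto simp: idem_def)
  ultimately show ?thesis
    using assms(2,3) by blast
qed

lemma amiable_Rstar_unique:
  fixes e f :: "'a::semigroup_mult"
  assumes "amiable TYPE('a)" "idem e" "idem f" "e * f = f" "f * e = e"
  shows "e = f"
proof -
  have "Rstar `` {e} \<in> UNIV // Rstar"
    by (simp add: quotientI)
  then have "\<exists>!g. g \<in> Rstar `` {e} \<and> idem g"
    by (rule amiable_def[THEN iffD1, OF assms(1), THEN conjunct2, THEN bspec])
  moreover have "f \<in> Rstar `` {e}" "e \<in> Rstar `` {e}"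
    using Rstar_idemI assms by (auto simp: idem_def)
  ultimately show ?thesis
    using assms(2,3) by blast
qed

section \<open>Homomorphisms from presented semigroups\<close>

lemma free_semigroup_induct [case_names gen mult]:
  assumes "\<And>g. P (gen g)" "\<And>g u. P u \<Longrightarrow> P (gen g * u)"
  shows "P w"
proof -
  have "xs \<noteq> [] \<Longrightarrow> P (Abs_free_semigroup xs)" for xs
  proof (induction xs)
    case (Cons x xs)
    show ?case
    proof (cases "xs = []")
      case True
      then show ?thesis
        using assms(1) by (simp add: gen_def)
    next
      case False
      then have "Abs_free_semigroup (x # xs) = gen x * Abs_free_semigroup xs"
        by (simp add: gen_def times_free_semigroup.abs_eq eq_onp_def)
      then show ?thesis
        using assms(2) Cons.IH False by simp
    qed
  qed simp
  then show ?thesis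
    by (metis Rep_free_semigroup Rep_free_semigroup_inverse mem_Collect_eq)
qed

text \<open>The value at \<open>[]\<close> is arbitrary; \<open>eval_word\<close> only evaluates
  nonempty lists.\<close>

fun eval_list :: "('g \<Rightarrow> 'a::semigroup_mult) \<Rightarrow> 'g list \<Rightarrow> 'a" where
  "eval_list f [] = undefined"
| "eval_list f [x] = f x"
| "eval_list f (x # y # ys) = f x * eval_list f (y # ys)"

lemma eval_list_append:
  "xs \<noteq> [] \<Longrightarrow> ys \<noteq> [] \<Longrightarrow> eval_list f (xs @ ys) = eval_list f xs * eval_list f ys"
proof (induction f xs rule: eval_list.induct)
  case (2 f x)
  then show ?case by (cases ys) auto
qed (auto simp: mult.assoc)

lift_definition eval_word :: "('g \<Rightarrow> 'a::semigroup_mult) \<Rightarrow> 'g free_semigroup \<Rightarrow> 'a" is eval_list .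

lemma eval_word_gen: "eval_word f (gen g) = f g"
  by transfer simp

lemma eval_word_mult: "eval_word f (u * v) = eval_word f u * eval_word f v"
  by transfer (rule eval_list_append)

lemma eval_word_cong:
  assumes "sg_cong R u v" "\<And>u v. (u, v) \<in> R \<Longrightarrow> eval_word f u = eval_word f v"
  shows "eval_word f u = eval_word f v"
  using assms(1) by induction (auto simp: assms(2) eval_word_mult)

lift_definition Fa :: sg_F is wa .
lift_definition Fb :: sg_F is wb .
lift_definition Ma :: sg_M is wa .
lift_definition Mb :: sg_M is wb .

lemma sg_F_rels: "Fa * Fa = Fa" "Fb * Fb = Fb"
  by (transfer, rule sg_cong.rel, simp add: F_rels_def)+

lemma sg_M_rels: "Ma * Ma = Ma" "Mb * Mb = Mb"
  "Ma * Mb * Ma = Mb * Ma * Mb" "Mb * Ma * Mb = Ma * Mb"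
  by (transfer, rule sg_cong.rel, simp add: M_rels_def)+

lemma sg_F_induct [case_names a b mult_a mult_b]:
  assumes "P Fa" "P Fb" "\<And>x. P x \<Longrightarrow> P (Fa * x)" "\<And>x. P x \<Longrightarrow> P (Fb * x)"
  shows "P x"
proof -
  have gens: "abs_sg_F (gen g) = Fa \<or> abs_sg_F (gen g) = Fb" for g
    by (cases g) (auto simp: Fa_def Fb_def wa_def wb_def)
  have "P (abs_sg_F w)" for w
  proof (induction w rule: free_semigroup_induct)
    case (gen g)
    then show ?case using assms gens by metis
  next
    case (mult g u)
    then show ?case using assms gens by (metis times_sg_F.abs_eq)
  qed
  then show ?thesis
    by (metis Quotient_abs_rep Quotient_sg_F)
qed

lemma sg_M_induct [case_names a b mult_a mult_b]:
  assumes "P Ma" "P Mb" "\<And>x. P x \<Longrightarrow> P (Ma * x)" "\<And>x. P x \<Longrightarrow> P (Mb * x)"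
  shows "P x"
proof -
  have gens: "abs_sg_M (gen g) = Ma \<or> abs_sg_M (gen g) = Mb" for g
    by (cases g) (auto simp: Ma_def Mb_def wa_def wb_def)
  have "P (abs_sg_M w)" for w
  proof (induction w rule: free_semigroup_induct)
    case (gen g)
    then show ?case using assms gens by metis
  next
    case (mult g u)
    then show ?case using assms gens by (metis times_sg_M.abs_eq)
  qed
  then show ?thesis
    by (metis Quotient_abs_rep Quotient_sg_M)
qed

text \<open>Universal property of the presentation: evaluation respects the relations, so the
  representative chosen by \<open>rep_sg_F\<close> does not matter.\<close>

lemma sg_F_hom:
  fixes a b :: "'a::semigroup_mult"
  assumes "idem a" "idem b"
  obtains \<phi> :: "sg_F \<Rightarrow> 'a" where "\<And>x y. \<phi> (x * y) = \<phi> x * \<phi> y" "\<phi> Fa = a" "\<phi> Fb = b"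
proof -
  define f where "f = (\<lambda>g. case g of LA \<Rightarrow> a | LB \<Rightarrow> b)"
  define \<phi> where "\<phi> x = eval_word f (rep_sg_F x)" for x
  have rels: "eval_word f u = eval_word f v" if "(u, v) \<in> F_rels" for u v
    using that assms
    by (auto simp: F_rels_def wa_def wb_def eval_word_gen eval_word_mult f_def idem_def)
  have abs: "\<phi> (abs_sg_F w) = eval_word f w" for w
    unfolding \<phi>_def
    by (rule eval_word_cong[OF _ rels])
      (use Quotient_sg_F Quotient_rep_abs_fold_unmap sg_cong.refl in fastforce)
  show thesis
  proof
    show "\<phi> (x * y) = \<phi> x * \<phi> y" for x y
      by (metis (no_types) abs Quotient_abs_rep Quotient_sg_F eval_word_mult times_sg_F.abs_eq)
    show "\<phi> Fa = a" "\<phi> Fb = b"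
      by (simp_all add: Fa_def Fb_def abs wa_def wb_def eval_word_gen f_def)
  qed
qed

lemma sg_M_hom:
  fixes a b :: "'a::semigroup_mult"
  assumes "idem a" "idem b" "a * b * a = b * a * b" "b * a * b = a * b"
  obtains \<phi> :: "sg_M \<Rightarrow> 'a" where "\<And>x y. \<phi> (x * y) = \<phi> x * \<phi> y" "\<phi> Ma = a" "\<phi> Mb = b"
proof -
  define f where "f = (\<lambda>g. case g of LA \<Rightarrow> a | LB \<Rightarrow> b)"
  define \<phi> where "\<phi> x = eval_word f (rep_sg_M x)" for x
  have rels: "eval_word f u = eval_word f v" if "(u, v) \<in> M_rels" for u v
    using that assms
    by (auto simp: M_rels_def wa_def wb_def eval_word_gen eval_word_mult f_def idem_def)
  have abs: "\<phi> (abs_sg_M w) = eval_word f w" for w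
    unfolding \<phi>_def
    by (rule eval_word_cong[OF _ rels])
      (use Quotient_sg_M Quotient_rep_abs_fold_unmap sg_cong.refl in fastforce)
  show thesis
  proof
    show "\<phi> (x * y) = \<phi> x * \<phi> y" for x y
      by (metis (no_types) abs Quotient_abs_rep Quotient_sg_M eval_word_mult times_sg_M.abs_eq)
    show "\<phi> Ma = a" "\<phi> Mb = b"
      by (simp_all add: Ma_def Mb_def abs wa_def wb_def eval_word_gen f_def)
  qed
qed

text \<open>Reduces avoidance to injective homomorphisms, whose images are the forbidden
  subsemigroups.\<close>

lemma not_avoids_iff:
  "\<not> avoids TYPE('a::semigroup_mult) TYPE('b::semigroup_mult) \<longleftrightarrow>
    (\<exists>\<phi> :: 'b \<Rightarrow> 'a. inj \<phi> \<and> (\<forall>x y. \<phi> (x * y) = \<phi> x * \<phi> y))"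
proof
  assume "\<exists>\<phi> :: 'b \<Rightarrow> 'a. inj \<phi> \<and> (\<forall>x y. \<phi> (x * y) = \<phi> x * \<phi> y)"
  then obtain \<phi> :: "'b \<Rightarrow> 'a" where \<phi>: "inj \<phi>" "\<And>x y. \<phi> (x * y) = \<phi> x * \<phi> y"
    by blast
  have "subsemigroup (range \<phi>)"
    unfolding subsemigroup_def using \<phi>(2) by (auto simp flip: \<phi>(2))
  moreover have "isomorphic_to (range \<phi>) TYPE('b)"
    unfolding isomorphic_to_def using \<phi> by (auto simp: bij_betw_def)
  ultimately show "\<not> avoids TYPE('a) TYPE('b)"
    unfolding avoids_def by blast
qed (auto simp: avoids_def isomorphic_to_def bij_betw_def)

text \<open>The first letter of a word is invariant under the congruence.\<close>

lemma sg_F_noncommuting: "Fa * Fb \<noteq> Fb * Fa"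
proof
  have hd_cong: "hd (Rep_free_semigroup u) = hd (Rep_free_semigroup v)"
    if "sg_cong F_rels u v" for u v
    using that
  proof induction
    case (mult u v u' v')
    then show ?case
      using Rep_free_semigroup[of u] Rep_free_semigroup[of v]
      by (simp add: times_free_semigroup.rep_eq)
  qed (auto simp: F_rels_def wa_def wb_def gen.rep_eq times_free_semigroup.rep_eq)
  assume "Fa * Fb = Fb * Fa"
  then have "sg_cong F_rels (wa * wb) (wb * wa)"
    by transfer
  from hd_cong[OF this] show False
    by (simp add: wa_def wb_def gen.rep_eq times_free_semigroup.rep_eq)
qed

lemma sg_M_noncommuting: "Ma * Mb \<noteq> Mb * Ma"
proof
  \<comment> \<open>The words other than \<open>b\<dots>ba\<dots>a\<close> form a class, the zero of \<open>M\<close>.\<close>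
  let ?srt = "sorted_wrt (\<lambda>x y. \<not> (x = LA \<and> y = LB))"
  \<comment> \<open>The letter set is carried along because the order condition on a product depends
    on which letters its factors contain.\<close>
  have srt_cong: "set (Rep_free_semigroup u) = set (Rep_free_semigroup v) \<and>
      ?srt (Rep_free_semigroup u) = ?srt (Rep_free_semigroup v)"
    if "sg_cong M_rels u v" for u v
    using that
    by induction (auto simp: M_rels_def wa_def wb_def gen.rep_eq times_free_semigroup.rep_eq
        sorted_wrt_append)
  assume "Ma * Mb = Mb * Ma"
  then have "sg_cong M_rels (wa * wb) (wb * wa)"
    by transfer
  from srt_cong[OF this] show False
    by (simp add: wa_def wb_def gen.rep_eq times_free_semigroup.rep_eq)
qed

lemma sg_M_cases: "x \<in> {Ma, Mb, Ma * Mb, Mb * Ma}"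
proof (induction x rule: sg_M_induct)
  case (mult_a x)
  then show ?case
    using sg_M_rels by (auto simp flip: mult.assoc)
next
  case (mult_b x)
  then show ?case
    using sg_M_rels by (auto simp flip: mult.assoc)
qed auto

text \<open>By \<open>sg_M_cases\<close> it suffices that \<open>c\<close>, \<open>d\<close>,
  \<open>z\<close> and \<open>d * c\<close> are distinct; any coincidence would force
  \<open>d * c = z\<close>.\<close>

lemma not_avoids_sg_M:
  fixes c d :: "'a::semigroup_mult"
  assumes cd: "idem c" "idem d" "c * d = z" and ne: "d * c \<noteq> z"
    and zero: "z * c = z" "c * z = z" "z * d = z" "d * z = z"
  shows "\<not> avoids TYPE('a) TYPE(sg_M)"
proof -
  have "c * d * c = d * c * d" "d * c * d = c * d"
    using cd zero by (simp_all add: mult.assoc)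
  then obtain \<phi> :: "sg_M \<Rightarrow> 'a"
    where hom: "\<And>x y. \<phi> (x * y) = \<phi> x * \<phi> y" and gens: "\<phi> Ma = c" "\<phi> Mb = d"
    using sg_M_hom cd by blast
  have "c \<noteq> z" "d \<noteq> z" "c \<noteq> d"
    using cd ne zero by auto
  moreover have "d * c \<noteq> c"
    using calculation cd zero by (metis idem_def mult.assoc)
  moreover have "d * c \<noteq> d"
    using calculation cd zero by (metis idem_def mult.assoc)
  ultimately have "\<phi> x = \<phi> y \<Longrightarrow> x = y" for x y
    using sg_M_cases[of x] sg_M_cases[of y] ne by (auto simp: hom gens cd)
  then show ?thesis
    using hom unfolding not_avoids_iff inj_def by blast
qed

section \<open>Alternating words\<close>

text \<open>\<open>alt n x y\<close> is the word \<open>xyxy\<dots>\<close> of length \<open>n + 1\<close>.\<close>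

fun alt :: "nat \<Rightarrow> 'a::semigroup_mult \<Rightarrow> 'a \<Rightarrow> 'a" where
  "alt 0 x y = x"
| "alt (Suc n) x y = x * alt n y x"

text \<open>With its n + 1 letters, \<open>alt n x y\<close> ends in \<open>x\<close> for even
  \<open>n\<close> and in \<open>y\<close> for odd \<open>n\<close>.\<close>

lemma alt_Suc_right: "alt (Suc n) x y = alt n x y * (if even n then y else x)"
proof (induction n arbitrary: x y)
  case (Suc n)
  have "alt (Suc (Suc n)) x y = x * (alt n y x * (if even n then x else y))"
    by (simp only: alt.simps(2)[of "Suc n"] Suc.IH)
  then show ?case
    by (simp add: mult.assoc)
qed simp

lemma alt_mult_last:
  assumes "idem x" "idem y"
  shows "alt n x y * (if even n then x else y) = alt n x y"
  using assms by (induction n arbitrary: x y) (auto simp: mult.assoc idem_def)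

lemma alt_first_mult: "idem x \<Longrightarrow> x * alt n x y = alt n x y"
  by (cases n) (auto simp: idem_def simp flip: mult.assoc)

lemma hom_alt:
  assumes "\<And>x y. \<phi> (x * y) = \<phi> x * \<phi> y"
  shows "\<phi> (alt n x y) = alt n (\<phi> x) (\<phi> y)"
  by (induction n arbitrary: x y) (auto simp: assms)

text \<open>A prefixed generator either lengthens an alternating word or is absorbed by its first
  letter.\<close>

lemma sg_F_eq_alt: "\<exists>n. x = alt n Fa Fb \<or> x = alt n Fb Fa"
proof (induction x rule: sg_F_induct)
  case a
  show ?case by (metis alt.simps(1))
next
  case b
  show ?case by (metis alt.simps(1))
next
  case (mult_a x)
  then show ?case
    by (metis alt.simps(2) alt_first_mult idem_def sg_F_rels(1))
next
  case (mult_b x)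
  then show ?case
    by (metis alt.simps(2) alt_first_mult idem_def sg_F_rels(2))
qed

lemma alt_collision_same_start:
  fixes a b :: "'a::semigroup_mult"
  assumes idem: "idem a" "idem b" and eq: "alt n a b = alt m b a"
  obtains k l where "k < l" "alt k a b = alt l a b \<or> alt k b a = alt l b a"
proof -
  have 1: "alt n a b = alt (Suc m) a b"
    using alt_first_mult[OF idem(1), of n b] by (simp add: eq)
  have 2: "alt (Suc n) b a = alt m b a"
    using alt_first_mult[OF idem(2), of m a] by (simp add: eq)
  \<comment> \<open>If \<open>n = Suc m\<close>, equation \<open>1\<close> is trivial, but
    \<open>2\<close> then relates distinct lengths.\<close>
  consider "n < Suc m" | "Suc m < n" | "m < Suc n" by linarith
  then show thesis
    by cases (use 1 2 that in metis)+
qed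

lemma alt_collision:
  fixes a b :: "'a::semigroup_mult"
  assumes idem: "idem a" "idem b" and F: "avoids TYPE('a) TYPE(sg_F)"
  obtains k l where "k < l" "alt k a b = alt l a b \<or> alt k b a = alt l b a"
proof -
  obtain \<phi> :: "sg_F \<Rightarrow> 'a"
    where hom: "\<And>x y. \<phi> (x * y) = \<phi> x * \<phi> y" and gens: "\<phi> Fa = a" "\<phi> Fb = b"
    using sg_F_hom idem by blast
  then obtain x y where xy: "\<phi> x = \<phi> y" "x \<noteq> y"
    using F not_avoids_iff[where 'a='a and 'b=sg_F] unfolding inj_def by blast
  have alts: "\<phi> (alt n Fa Fb) = alt n a b" "\<phi> (alt n Fb Fa) = alt n b a" for n
    by (simp_all add: hom_alt[OF hom] gens)
  obtain n m where "x = alt n Fa Fb \<or> x = alt n Fb Fa" "y = alt m Fa Fb \<or> y = alt m Fb Fa"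
    using sg_F_eq_alt by metis
  then consider
      "n \<noteq> m" "alt n a b = alt m a b" | "n \<noteq> m" "alt n b a = alt m b a"
    | "alt n a b = alt m b a" | "alt n b a = alt m a b"
    using xy alts by metis
  then show thesis
  proof cases
    case 1
    then show ?thesis using that by (metis linorder_neqE_nat)
  next
    case 2
    then show ?thesis using that by (metis linorder_neqE_nat)
  next
    case 3
    then show ?thesis using alt_collision_same_start[OF idem] that by blast
  next
    case 4
    then show ?thesis using alt_collision_same_start[OF idem, of m n] that by metis
  qed
qed

text \<open>Words of odd index are powers of \<open>a * b\<close>, so the collision becomes one
  between powers.\<close>

lemma alt_collision_odd:
  fixes a b :: "'a::semigroup_mult"
  assumes idem: "idem a" "idem b" and lt: "k < l" and eq: "alt k a b = alt l a b"
  obtains i j where "i < j" "alt (2 * i + 1) a b = alt (2 * j + 1) a b"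
proof -
  obtain l' where l': "k < l'" "even k = even l'" "alt k a b = alt l' a b"
  proof (cases "even k = even l")
    case False
    \<comment> \<open>The last letter of the left word is absorbed there but lengthens the right
      word, whose last letter differs; this equalizes the parities.\<close>
    have "alt k a b = alt l a b * (if even l then b else a)"
      using alt_mult_last[OF idem, of k] False eq by (auto split: if_splits)
    also have "\<dots> = alt (Suc l) a b"
      by (rule alt_Suc_right[symmetric])
    finally show ?thesis
      using that[of "Suc l"] lt False by auto
  qed (use lt eq that in blast)
  show thesis
  proof (cases "even k")
    case True
    then have "alt (Suc k) a b = alt (Suc l') a b"
      using l' by (simp only: alt_Suc_right)
    moreover obtain i j where "k = 2 * i" "l' = 2 * j"
      using True l'(2) by (metis evenE)
    ultimately show ?thesis
      using that[of i j] l'(1) by simp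
  next
    case False
    then obtain i j where "k = 2 * i + 1" "l' = 2 * j + 1"
      using l'(2) by (metis oddE)
    then show ?thesis
      using that[of i j] l'(1,3) by simp
  qed
qed

lemma alt_odd_mult: "alt (2 * i + 1) a b * alt (2 * j + 1) a b = alt (2 * (i + j + 1) + 1) a b"
  by (induction i) (auto simp: mult.assoc)

text \<open>Semigroups have no power operation; \<open>q i\<close> stands for the power with exponent \<open>i + 1\<close>.\<close>

lemma idempotent_power:
  fixes q :: "nat \<Rightarrow> 'a::semigroup_mult"
  assumes q: "\<And>i j. q i * q j = q (i + j + 1)" and lt: "i < j" and eq: "q i = q j"
  obtains n where "idem (q n)"
proof -
  define d where "d = j - i"
  have d: "d > 0" "q i = q (i + d)"
    using lt eq by (auto simp: d_def)
  have shift: "q k = q (k + d)" if "k \<ge> i" for k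
  proof (cases "k = i")
    case False
    with that obtain t where "k = i + t + 1"
      by (metis add.commute add_Suc_right le_neq_implies_less less_iff_Suc_add plus_1_eq_Suc)
    then show ?thesis
      using q[of i t] q[of "i + d" t] d(2) by (simp add: algebra_simps)
  qed (use d in auto)
  have period: "q k = q (k + r * d)" if "k \<ge> i" for k r
  proof (induction r)
    case (Suc r)
    then show ?case
      using shift[of "k + r * d"] that by (simp add: algebra_simps)
  qed simp
  \<comment> \<open>The exponent n + 1 is a multiple of the period \<open>d\<close> and exceeds
    \<open>i\<close>, so doubling it does not change the power.\<close>
  define n where "n = (i + 1) * d - 1"
  have n: "n + 1 = (i + 1) * d"
    using d(1) by (simp add: n_def)
  moreover have "(i + 1) * d \<ge> i + 1"
    using mult_le_mono2[of 1 d "i + 1"] d(1) by simp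
  ultimately have "q n = q (n + (n + 1))"
    using period[of n "i + 1"] by simp
  then have "idem (q n)"
    using q[of n n] by (simp add: idem_def add.assoc)
  then show thesis by (rule that)
qed

section \<open>Two idempotents generating a zero\<close>

text \<open>\<open>e * a\<close> is an idempotent related to \<open>e\<close> by
  \<open>Rstar\<close>, and \<open>b * e\<close> is one related to \<open>e\<close> by
  \<open>Lstar\<close>.\<close>

lemma amiable_absorbing:
  fixes a b e :: "'a::semigroup_mult"
  assumes am: "amiable TYPE('a)" and idem: "idem e" "idem a" "idem b"
    and ae: "a * e = e" and eb: "e * b = e"
  shows "e * a = e" "b * e = e"
proof -
  have "idem (e * a)" "idem (b * e)"
    using idem ae eb unfolding idem_def by (metis mult.assoc)+
  moreover have "e * (e * a) = e * a" "e * a * e = e" "b * e * e = b * e" "e * (b * e) = e"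
    using idem ae eb unfolding idem_def by (metis mult.assoc)+
  ultimately show "e * a = e" "b * e = e"
    using amiable_Rstar_unique[OF am] amiable_Lstar_unique[OF am] idem(1) by metis+
qed

text \<open>Here \<open>z\<close> is the zero and \<open>w\<close> the last nonzero alternating
  word; \<open>c\<close> and \<open>a\<close> play the roles of \<open>Ma\<close> and
  \<open>Mb\<close>.\<close>

lemma not_avoids_sg_M_last_nonzero:
  fixes a b z w :: "'a::semigroup_mult"
  assumes am: "amiable TYPE('a)" and idem: "idem a" "idem b"
    and zero: "a * z = z" "z * a = z" "b * z = z" "z * b = z" "idem z"
    and w: "w \<noteq> z" "w * a = z" "w * b = w" "w = u * (a * b)"
    and wz: "w * z = z" "z * w = z" "u * z = z"
  shows "\<not> avoids TYPE('a) TYPE(sg_M)"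
proof -
  obtain c where c: "(w, c) \<in> Lstar" "idem c"
    using amiable_Lstar_idem[OF am] .
  have wc: "w * c = w"
    using Lstar_idem_right_identity c .
  have "w * b = w * c"
    using w(3) wc by simp
  then have cb: "c * b = c"
    using Lstar_cancel[OF c(1)] c(2) unfolding idem_def by metis
  have zc: "z * c = z"
    using wc wz(2) by (metis mult.assoc)
  have cz: "c * z = z"
  proof (rule amiable_Lstar_unique[OF am])
    show "idem (c * z)"
      using zc zero(5) unfolding idem_def by (metis mult.assoc)
    show "idem z" by fact
    show "c * z * z = c * z" "z * (c * z) = z"
      using zc zero(5) unfolding idem_def by (metis mult.assoc)+
  qed
  have bc: "b * c = c"
  proof (rule amiable_Lstar_unique[OF am])
    show "idem (b * c)"
      using cb c(2) unfolding idem_def by (metis mult.assoc)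
    show "idem c" by fact
    show "b * c * c = b * c" "c * (b * c) = c"
      using cb c(2) unfolding idem_def by (metis mult.assoc)+
  qed
  \<comment> \<open>Both \<open>w * a\<close> and \<open>w * z\<close> equal \<open>z\<close>, and
    \<open>Lstar\<close> carries this equality over to \<open>c\<close>.\<close>
  have "c * a = c * z"
    by (rule Lstar_cancel[OF c(1)]) (simp add: w(2) wz(1))
  then have ca: "c * a = z"
    by (simp add: cz)
  have "a * c \<noteq> z"
  proof
    assume "a * c = z"
    then have "w * c = u * z"
      by (simp add: w(4) mult.assoc bc)
    then show False
      using wc wz(3) w(1) by simp
  qed
  then show ?thesis
    using not_avoids_sg_M c(2) idem(1) ca zc cz zero by metis
qed

lemma not_avoids_sg_M_collision:
  fixes a b :: "'a::semigroup_mult"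
  assumes am: "amiable TYPE('a)" and idem: "idem a" "idem b" and comm: "a * b \<noteq> b * a"
    and coll: "k < l" "alt k a b = alt l a b"
  shows "\<not> avoids TYPE('a) TYPE(sg_M)"
proof -
  define q where "q i = alt (2 * i + 1) a b" for i
  have q_mult: "q i * q j = q (i + j + 1)" for i j
    unfolding q_def by (rule alt_odd_mult)
  have q0: "q 0 = a * b"
    by (simp add: q_def)
  obtain i j where "i < j" "q i = q j"
    using alt_collision_odd[OF idem coll] unfolding q_def by metis
  then obtain n where n: "idem (q n)"
    using idempotent_power[of q] q_mult by blast
  define z where "z = q n"
  have q_b: "q i * b = q i" for i
    using alt_mult_last[OF idem, of "2 * i + 1"] by (simp add: q_def)
  have a_q: "a * q i = q i" for i
    unfolding q_def by (rule alt_first_mult[OF idem(1)])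
  have zero: "a * z = z" "z * a = z" "b * z = z" "z * b = z" and z: "idem z"
    using n a_q[of n] q_b[of n] amiable_absorbing[OF am n idem] by (auto simp: z_def)
  have q_Suc: "q (Suc j) = q j * (a * b)" for j
    using q_mult[of j 0] by (simp add: q0)
  have zq: "z * q i = z" for i
  proof (induction i)
    case (Suc i)
    then show ?case using q_Suc zero by (metis mult.assoc)
  qed (simp add: q0 zero flip: mult.assoc)
  have qz: "q i * z = z" for i
    by (induction i) (simp_all add: q0 q_Suc zero mult.assoc)
  show ?thesis
  proof (cases "a * b = z")
    case True
    then show ?thesis
      using not_avoids_sg_M[OF idem True _ ] comm zero by metis
  next
    case False
    \<comment> \<open>Descending from \<open>q n = z\<close> to \<open>q 0 \<noteq> z\<close> meets
      a step where the power becomes nonzero.\<close>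
    then obtain i where i: "q i \<noteq> z" "q (Suc i) = z"
      using inc_induct[of 0 n "\<lambda>i. q i = z"] z_def q0 by force
    show ?thesis
    \<comment> \<open>The last nonzero word is \<open>q i\<close> or \<open>q i * a\<close>; in the
      second case \<open>a\<close> and \<open>b\<close> swap roles.\<close>
    proof (cases "q i * a = z")
      case True
      \<comment> \<open>For \<open>i = 0\<close> the empty prefix is replaced by \<open>a\<close>,
        which \<open>a * b\<close> absorbs.\<close>
      obtain u where u: "q i = u * (a * b)" "u * z = z"
      proof (cases i)
        case 0
        then show ?thesis
          using that[of a] a_q[of 0] q0 zero by simp
      next
        case (Suc j)
        then show ?thesis
          using that[of "q j"] q_Suc qz by simp
      qed
      show ?thesis
        by (rule not_avoids_sg_M_last_nonzero[OF am idem zero z i(1) True q_b u(1) qz zq u(2)])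
    next
      case nz: False
      show ?thesis
      proof (rule not_avoids_sg_M_last_nonzero[OF am idem(2,1) zero(3,4,1,2) z nz])
        show "q i * a * b = z"
          using i(2) q_Suc by (simp add: mult.assoc)
        show "q i * a * a = q i * a"
          using idem(1) by (simp add: idem_def mult.assoc)
        show "q i * a = q i * (b * a)"
          by (simp add: q_b flip: mult.assoc)
        show "q i * a * z = z" "z * (q i * a) = z"
          using zero qz zq by (metis mult.assoc)+
        show "q i * z = z"
          by (rule qz)
      qed
    qed
  qed
qed

theorem mainTheorem1:
  assumes "amiable TYPE('a::semigroup_mult)"
  shows "adequate TYPE('a) \<longleftrightarrow> avoids TYPE('a) TYPE(sg_F) \<and> avoids TYPE('a) TYPE(sg_M)"
proof
  assume "adequate TYPE('a)"
  then have comm: "e * f = f * e" if "idem e" "idem f" for e f :: 'a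
    using that unfolding adequate_def by blast
  have "avoids TYPE('a) TYPE(sg_F)"
  proof (rule ccontr)
    assume "\<not> ?thesis"
    then obtain \<phi> :: "sg_F \<Rightarrow> 'a" where \<phi>: "inj \<phi>" "\<And>x y. \<phi> (x * y) = \<phi> x * \<phi> y"
      unfolding not_avoids_iff by blast
    have "\<phi> (Fa * Fb) = \<phi> (Fb * Fa)"
      using comm[of "\<phi> Fa" "\<phi> Fb"] \<phi>(2) sg_F_rels by (metis idem_def)
    then show False
      using \<phi>(1) sg_F_noncommuting by (simp add: inj_eq)
  qed
  moreover have "avoids TYPE('a) TYPE(sg_M)"
  proof (rule ccontr)
    assume "\<not> ?thesis"
    then obtain \<phi> :: "sg_M \<Rightarrow> 'a" where \<phi>: "inj \<phi>" "\<And>x y. \<phi> (x * y) = \<phi> x * \<phi> y"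
      unfolding not_avoids_iff by blast
    have "\<phi> (Ma * Mb) = \<phi> (Mb * Ma)"
      using comm[of "\<phi> Ma" "\<phi> Mb"] \<phi>(2) sg_M_rels by (metis idem_def)
    then show False
      using \<phi>(1) sg_M_noncommuting by (simp add: inj_eq)
  qed
  ultimately show "avoids TYPE('a) TYPE(sg_F) \<and> avoids TYPE('a) TYPE(sg_M)" ..
next
  assume av: "avoids TYPE('a) TYPE(sg_F) \<and> avoids TYPE('a) TYPE(sg_M)"
  have "abundant TYPE('a)"
    using assms unfolding amiable_def abundant_def Ex1_def by meson
  moreover have "e * f = f * e" if ef: "idem e" "idem f" for e f :: 'a
  proof (rule ccontr)
    assume ne: "e * f \<noteq> f * e"
    obtain k l where "k < l" "alt k e f = alt l e f \<or> alt k f e = alt l f e"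
      using alt_collision ef av by blast
    \<comment> \<open>A collision of words starting with \<open>f\<close> is handled by exchanging
      \<open>e\<close> and \<open>f\<close>.\<close>
    then show False
      using not_avoids_sg_M_collision[OF assms] ef ne av by metis
  qed
  ultimately show "adequate TYPE('a)"
    unfolding adequate_def by blast
qed

end
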